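(* Every baker's map in the group $2V$ is a product of finitely many proper transpositions belonging to $2V$.
   Context: Let $S=[0,1)^2$ be the (half-open) unit square. A rectangle $[a,b)\times[c,d)$ can be divided vertically, into its left half $[a,\frac{a+b}{2})\times[c,d)$ and right half $[\frac{a+b}{2},b)\times[c,d)$, or horizontally, into its lower half $[a,b)\times[c,\frac{c+d}{2})$ and upper half $[a,b)\times[\frac{c+d}{2},d)$. A pattern is a finite partition of $S$ into rectangles obtained from the trivial partition $\{S\}$ by a finite (possibly empty) sequence of steps, each replacing one rectangle of the current partition by its two halves under a vertical or a horizontal division. A numbered pattern is a pattern whose rectangles are indexed $0,1,\dots,k-1$, where $k$ is the number of rectangles. A pair of numbered patterns $(P_0,\dots,P_{k-1})$ (domain) and $(Q_0,\dots,Q_{k-1})$ (range) with the same number $k$ of rectangles determines the bijection $S\to S$ that, for each $i$, carries $P_i=[a,b)\times[c,d)$ onto $Q_i=[a',b')\times[c',d')$ by the map $(x,y)\mapsto\left(a'+\frac{b'-a'}{b-a}(x-a),\; c'+\frac{d'-c'}{d-c}(y-c)\right)$. The group $2V$ is the group, under composition, of all bijections of $S$ arising in this way. (Different pairs of numbered patterns may determine the same element. Equivalently, $2V$ can be viewed as a group of homeomorphisms of the product of two Cantor sets.) Transposition: an element of $2V$ given by a pair of numbered patterns whose underlying patterns are identical and whose numberings are identical except that two of the numbers are switched (so it interchanges two distinct rectangles of one pattern by the axis-preserving increasing affine maps and is the identity on all other rectangles of the pattern). A transposition is proper if there are more than two rectangles in each of the two patterns. Baker's map: let $R=[a,b)\times[c,d)$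 be any rectangle occurring in some pattern (possibly $R=S$). The baker's map with support $R$ is the element of $2V$ that is the identity outside $R$, carries the left half of $R$ onto the lower half of $R$ by the increasing coordinatewise affine map $(x,y)\mapsto\left(a+2(x-a),\; c+\frac{1}{2}(y-c)\right)$, and carries the right half of $R$ onto the upper half of $R$ by the increasing coordinatewise affine map $(x,y)\mapsto\left(a+2\left(x-\frac{a+b}{2}\right),\; \frac{c+d}{2}+\frac{1}{2}(y-c)\right)$. (In terms of patterns: the domain and range patterns are identical and identically numbered, except that $R$ is divided once vertically in the domain and once horizontally in the range, with left half corresponding to lower half and right half to upper half. The case $R=S$ is the primary baker's map; the case $R\neq S$ is a secondary baker's map.) A baker's map in $2V$ means either kind. *)

theory Defs
  imports Complex_Main "HOL-Algebra.Bij"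
begin

type_synonym point = "real \<times> real"

(* Rect a b c d stands for [a,b) x [c,d). *)
datatype rect = Rect real real real real

fun region :: "rect \<Rightarrow> point set" where
  "region (Rect a b c d) = {a..<b} \<times> {c..<d}"

fun left_half :: "rect \<Rightarrow> rect" where
  "left_half (Rect a b c d) = Rect a ((a + b) / 2) c d"

fun right_half :: "rect \<Rightarrow> rect" where
  "right_half (Rect a b c d) = Rect ((a + b) / 2) b c d"

fun lower_half :: "rect \<Rightarrow> rect" where
  "lower_half (Rect a b c d) = Rect a b c ((c + d) / 2)"

fun upper_half :: "rect \<Rightarrow> rect" where
  "upper_half (Rect a b c d) = Rect a b ((c + d) / 2) d"

definition unit_rect :: rect where
  "unit_rect = Rect 0 1 0 1"

definition unit_square :: "point set" where
  "unit_square = region unit_rect"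

inductive pattern :: "rect set \<Rightarrow> bool" where
  trivial: "pattern {unit_rect}"
| vertical: "pattern P \<Longrightarrow> R \<in> P \<Longrightarrow> pattern (P - {R} \<union> {left_half R, right_half R})"
| horizontal: "pattern P \<Longrightarrow> R \<in> P \<Longrightarrow> pattern (P - {R} \<union> {lower_half R, upper_half R})"

definition numbered_pattern :: "rect list \<Rightarrow> bool" where
  "numbered_pattern Ps \<longleftrightarrow> distinct Ps \<and> pattern (set Ps)"

fun rect_map :: "rect \<Rightarrow> rect \<Rightarrow> point \<Rightarrow> point" where
  "rect_map (Rect a b c d) (Rect a' b' c' d') (x, y) =
     (a' + (b' - a') / (b - a) * (x - a), c' + (d' - c') / (d - c) * (y - c))"

(* Elements of Bij unit_square are undefined outside unit_square, and the regions of Ps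
   cover it, so f is uniquely determined by Ps and Qs. *)
definition induced_by :: "rect list \<Rightarrow> rect list \<Rightarrow> (point \<Rightarrow> point) \<Rightarrow> bool" where
  "induced_by Ps Qs f \<longleftrightarrow>
     numbered_pattern Ps \<and> numbered_pattern Qs \<and> length Ps = length Qs \<and>
     f \<in> Bij unit_square \<and>
     (\<forall>i < length Ps. \<forall>p \<in> region (Ps ! i). f p = rect_map (Ps ! i) (Qs ! i) p)"

definition two_V :: "(point \<Rightarrow> point) monoid" where
  "two_V = (BijGroup unit_square) \<lparr>carrier := {f. \<exists>Ps Qs. induced_by Ps Qs f}\<rparr>"

definition proper_transposition :: "(point \<Rightarrow> point) \<Rightarrow> bool" where
  "proper_transposition f \<longleftrightarrow>
     (\<exists>Ps i j. length Ps > 2 \<and> i < length Ps \<and> j < length Ps \<and> i \<noteq> j \<and>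
        induced_by Ps (Ps[i := Ps ! j, j := Ps ! i]) f)"

definition baker :: "rect \<Rightarrow> point \<Rightarrow> point" where
  "baker R = (\<lambda>p \<in> unit_square.
     if p \<in> region (left_half R) then rect_map (left_half R) (lower_half R) p
     else if p \<in> region (right_half R) then rect_map (right_half R) (upper_half R) p
     else p)"

lemma rect_map_left_lower:
  assumes "a < b" "c < d"
  shows "rect_map (left_half (Rect a b c d)) (lower_half (Rect a b c d)) (x, y) =
           (a + 2 * (x - a), c + 1 / 2 * (y - c))"
  using assms by (simp add: field_simps)

lemma rect_map_right_upper:
  assumes "a < b" "c < d"
  shows "rect_map (right_half (Rect a b c d)) (upper_half (Rect a b c d)) (x, y) =
           (a + 2 * (x - (a + b) / 2), (c + d) / 2 + 1 / 2 * (y - c))"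
  using assms by (simp add: field_simps)

definition baker_map :: "(point \<Rightarrow> point) \<Rightarrow> bool" where
  "baker_map f \<longleftrightarrow> (\<exists>P R. pattern P \<and> R \<in> P \<and> f = baker R)"

end

(*
  The baker's map of a rectangle R is the product of the baker's maps of its left and right
  halves followed by a swap of two quarters of R.  Hence, if T is the group generated by proper
  transpositions, it suffices to treat secondary baker's maps.  For disjoint rectangles R, R'
  of a pattern, with s their swap, b_R b_R'^-1 = (b_R s b_R^-1) s, and the conjugate is again
  a product of two swaps; so T b_R = T b_R'.  Write L, M for the halves of R and t for the swap
  of quarters.  Then b_R = t b_L b_M, while b_M lies in T b_R' = T b_R; cancelling b_R
  on the right gives b_L in T, so b_M and b_R are in T as well.
*)
theory Submission
  imports Defs "HOL-Algebra.Generated_Groups"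
begin

section \<open>Rectangles and affine maps between them\<close>

fun nondegenerate :: "rect \<Rightarrow> bool" where
  "nondegenerate (Rect a b c d) \<longleftrightarrow> a < b \<and> c < d"

text \<open>Treats both directions of a cut at once, so that cover, disjointness and refinement are
  each proved a single time.\<close>

definition division :: "rect \<Rightarrow> rect \<Rightarrow> rect \<Rightarrow> bool" where
  "division R A B \<longleftrightarrow>
     A = left_half R \<and> B = right_half R \<or> A = lower_half R \<and> B = upper_half R"

lemma division_halves:
  "division R (left_half R) (right_half R)" "division R (lower_half R) (upper_half R)"
  by (simp_all add: division_def)

text \<open>Cuts along different axes act on different coordinates. A quarter can thus be read as a
  half of either kind of half, which is how a baker's map is compared with those of the halves of
  its support.\<close>

lemma half_of_half_commute:
  "left_half (lower_half R) = lower_half (left_half R)"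
  "right_half (lower_half R) = lower_half (right_half R)"
  "left_half (upper_half R) = upper_half (left_half R)"
  "right_half (upper_half R) = upper_half (right_half R)"
  by (cases R; simp)+

lemma region_nonempty: "nondegenerate R \<Longrightarrow> region R \<noteq> {}"
  by (cases R) auto

lemma division_region:
  assumes "nondegenerate R" "division R A B"
  shows "region R = region A \<union> region B" "region A \<inter> region B = {}"
    "nondegenerate A" "nondegenerate B"
proof -
  obtain a b c d where R: "R = Rect a b c d" by (cases R)
  then have ab: "a < (a + b) / 2" "(a + b) / 2 < b" and cd: "c < (c + d) / 2" "(c + d) / 2 < d"
    using assms(1) by simp_all
  show "region R = region A \<union> region B" "region A \<inter> region B = {}"
    "nondegenerate A" "nondegenerate B"
    using assms(2) ab cd by (auto simp: R division_def simp del: times_divide_eq_left)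
qed

lemma division_distinct:
  assumes "nondegenerate R" "division R A B"
  shows "A \<noteq> B"
  using division_region(2,3)[OF assms] region_nonempty[of A] by auto

lemma affine_mem_interval:
  fixes a b a' b' x :: real
  assumes "a < b" "a' < b'" "a \<le> x" "x < b"
  shows "a' \<le> a' + (b' - a') / (b - a) * (x - a)" "a' + (b' - a') / (b - a) * (x - a) < b'"
proof -
  show "a' \<le> a' + (b' - a') / (b - a) * (x - a)" using assms by simp
  have "(b' - a') / (b - a) * (x - a) < (b' - a') / (b - a) * (b - a)"
    using assms by (intro mult_strict_left_mono) auto
  also have "\<dots> = b' - a'" using assms by simp
  finally show "a' + (b' - a') / (b - a) * (x - a) < b'" by simp
qed

lemma rect_map_in_region:
  assumes "nondegenerate A" "nondegenerate B" "p \<in> region A"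
  shows "rect_map A B p \<in> region B"
proof -
  obtain a b c d where A: "A = Rect a b c d" by (cases A)
  obtain a' b' c' d' where B: "B = Rect a' b' c' d'" by (cases B)
  obtain x y where p: "p = (x, y)" by (cases p)
  show ?thesis
    using assms affine_mem_interval[of a b a' b' x] affine_mem_interval[of c d c' d' y]
    by (simp add: A B p)
qed

lemma rect_map_self: "nondegenerate A \<Longrightarrow> rect_map A A p = p"
  by (cases A; cases p) simp

lemma rect_map_comp:
  "nondegenerate B \<Longrightarrow> rect_map B C (rect_map A B p) = rect_map A C p"
  by (cases A; cases B; cases C; cases p) simp

text \<open>An increasing affine map between intervals carries midpoint to midpoint, so its
  restriction to either half has the same slope. The lower half keeps the base point; the upper half
  is based at the midpoint, which lies on the same line.\<close>

lemma affine_halves: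
  fixes s t s' t' z :: real
  assumes "s < t"
  shows "((s' + t') / 2 - s') / ((s + t) / 2 - s) = (t' - s') / (t - s)"
    and "(s' + t') / 2 + (t' - (s' + t') / 2) / (t - (s + t) / 2) * (z - (s + t) / 2)
      = s' + (t' - s') / (t - s) * (z - s)"
proof -
  have low: "(u + v) / 2 - u = (v - u) / 2" and high: "v - (u + v) / 2 = (v - u) / 2"
    for u v :: real by (simp_all add: field_simps)
  have scale: "u / 2 / (v / 2) = u / v" for u v :: real by simp
  show "((s' + t') / 2 - s') / ((s + t) / 2 - s) = (t' - s') / (t - s)"
    unfolding low by (rule scale)
  \<comment> \<open>Once \<open>t'\<close> is expressed through the common slope \<open>k\<close>, a
    polynomial identity remains.\<close>
  define k where "k = (t' - s') / (t - s)"
  have k: "t' = s' + k * (t - s)" using assms by (simp add: k_def)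
  have "(t' - (s' + t') / 2) / (t - (s + t) / 2) = k"
    unfolding high scale k_def ..
  then show "(s' + t') / 2 + (t' - (s' + t') / 2) / (t - (s + t) / 2) * (z - (s + t) / 2)
      = s' + (t' - s') / (t - s) * (z - s)"
    by (simp only: k_def[symmetric]) (simp add: k field_simps)
qed

text \<open>Allows a map between corresponding halves to be traded for the map between the whole
  rectangles. The halved coordinate is an instance of \<open>affine_halves\<close>; the other one is
  untouched.\<close>

lemma rect_map_halves:
  assumes "nondegenerate A"
  shows "rect_map (left_half A) (left_half B) p = rect_map A B p"
  "rect_map (right_half A) (right_half B) p = rect_map A B p"
  "rect_map (lower_half A) (lower_half B) p = rect_map A B p"
  "rect_map (upper_half A) (upper_half B) p = rect_map A B p"
proof -
  obtain a b c d where A: "A = Rect a b c d" by (cases A)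
  obtain a' b' c' d' where B: "B = Rect a' b' c' d'" by (cases B)
  obtain x y where p: "p = (x, y)" by (cases p)
  have "a < b" "c < d" using assms by (simp_all add: A)
  then show "rect_map (left_half A) (left_half B) p = rect_map A B p"
  "rect_map (right_half A) (right_half B) p = rect_map A B p"
  "rect_map (lower_half A) (lower_half B) p = rect_map A B p"
  "rect_map (upper_half A) (upper_half B) p = rect_map A B p"
    unfolding A B p left_half.simps right_half.simps lower_half.simps upper_half.simps rect_map.simps
    by (simp_all only: affine_halves)
qed

section \<open>The geometry of patterns\<close>

lemma pattern_division:
  assumes "pattern P" "R \<in> P" "division R A B"
  shows "pattern (P - {R} \<union> {A, B})"
  using assms pattern.vertical pattern.horizontal unfolding division_def by blast

text \<open>The geometric invariant of a pattern, without its history of cuts.\<close>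

definition rect_partition :: "rect set \<Rightarrow> bool" where
  "rect_partition P \<longleftrightarrow> finite P \<and> (\<forall>R\<in>P. nondegenerate R) \<and>
     (\<Union>R\<in>P. region R) = unit_square \<and>
     (\<forall>R\<in>P. \<forall>R'\<in>P. R \<noteq> R' \<longrightarrow> region R \<inter> region R' = {})"

text \<open>The two pieces miss each other, together restore \<open>R\<close>, and lie inside it, so
  they miss every other rectangle.\<close>

lemma rect_partition_division:
  assumes P: "rect_partition P" and R: "R \<in> P" and div: "division R A B"
  shows "rect_partition (P - {R} \<union> {A, B})"
proof -
  have nd: "nondegenerate R" using P R by (simp add: rect_partition_def)
  note dR = division_region[OF nd div]
  have disj: "region C \<inter> region R = {}" if "C \<in> P - {R}" for C
    using P R that unfolding rect_partition_def by blast
  have disj': "region C \<inter> region A = {}" "region C \<inter> region B = {}" if "C \<in> P - {R}" for C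
    using disj[OF that] dR(1) by blast+
  have "(\<Union>C\<in>P. region C) = (\<Union>C\<in>P - {R}. region C) \<union> region R"
    using R by blast
  then have un: "(\<Union>C\<in>P - {R} \<union> {A, B}. region C) = unit_square"
    using P dR(1) unfolding rect_partition_def by auto
  have dj: "region C \<inter> region D = {}"
    if "C \<in> P - {R} \<union> {A, B}" "D \<in> P - {R} \<union> {A, B}" "C \<noteq> D" for C D
    using that P disj' dR(2) unfolding rect_partition_def by blast
  show ?thesis unfolding rect_partition_def
  proof (intro conjI ballI impI)
    show "finite (P - {R} \<union> {A, B})" using P by (simp add: rect_partition_def)
    show "nondegenerate C" if "C \<in> P - {R} \<union> {A, B}" for C
      using that P dR(3,4) unfolding rect_partition_def by blast
  qed (use un dj in blast)+
qed

lemma pattern_rect_partition: "pattern P \<Longrightarrow> rect_partition P"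
proof (induction rule: pattern.induct)
  case trivial
  show ?case by (simp add: rect_partition_def unit_square_def unit_rect_def)
qed (use rect_partition_division division_halves in metis)+

lemma
  assumes "pattern P"
  shows pattern_finite: "finite P"
    and pattern_nondegenerate: "R \<in> P \<Longrightarrow> nondegenerate R"
    and pattern_disjoint: "R \<in> P \<Longrightarrow> R' \<in> P \<Longrightarrow> R \<noteq> R' \<Longrightarrow> region R \<inter> region R' = {}"
    and pattern_region_subset: "R \<in> P \<Longrightarrow> region R \<subseteq> unit_square"
  using pattern_rect_partition[OF assms] unfolding rect_partition_def by blast+

section \<open>Swaps and baker's maps as bijections\<close>

text \<open>A transposition as a function, with no pattern attached: identities can be checked
  pointwise, and a pattern that makes the swap proper is supplied only later.\<close>

definition swap :: "rect \<Rightarrow> rect \<Rightarrow> point \<Rightarrow> point" where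
  "swap A B = (\<lambda>p \<in> unit_square.
     if p \<in> region A then rect_map A B p
     else if p \<in> region B then rect_map B A p
     else p)"

lemma BijI_inverse:
  assumes "f \<in> extensional S" "\<And>p. p \<in> S \<Longrightarrow> f p \<in> S \<and> g (f p) = p"
    "\<And>p. p \<in> S \<Longrightarrow> g p \<in> S \<and> f (g p) = p"
  shows "f \<in> Bij S"
  unfolding Bij_def using assms bij_betw_byWitness[of S g f S] by auto

lemma baker_extensional: "baker R \<in> extensional unit_square"
  by (simp add: baker_def)

lemma swap_extensional: "swap A B \<in> extensional unit_square"
  by (simp add: swap_def)

lemma swap_outside:
  "p \<in> unit_square \<Longrightarrow> p \<notin> region A \<Longrightarrow> p \<notin> region B \<Longrightarrow> swap A B p = p"
  by (simp add: swap_def)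

text \<open>Conditions under which \<open>swap A B\<close> is an involution of the square. They
  mention no pattern, so they pass directly to subrectangles.\<close>

locale rect_pair =
  fixes A B :: rect
  assumes nondegenerate: "nondegenerate A" "nondegenerate B"
    and subset: "region A \<subseteq> unit_square" "region B \<subseteq> unit_square"
    and disjoint: "region A \<inter> region B = {}"
begin

lemma swap_fst: "p \<in> region A \<Longrightarrow> swap A B p = rect_map A B p"
  using subset by (auto simp: swap_def)

lemma swap_snd: "p \<in> region B \<Longrightarrow> swap A B p = rect_map B A p"
  using subset disjoint by (auto simp: swap_def)

lemma swap_involution:
  assumes "p \<in> unit_square"
  shows "swap A B p \<in> unit_square \<and> swap A B (swap A B p) = p"
proof -
  consider "p \<in> region A" | "p \<in> region B" | "p \<notin> region A" "p \<notin> region B" by blast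
  then show ?thesis
  proof cases
    case 1
    then have "rect_map A B p \<in> region B" by (simp add: nondegenerate rect_map_in_region)
    then show ?thesis using 1 subset
      by (auto simp: swap_fst swap_snd rect_map_comp rect_map_self nondegenerate)
  next
    case 2
    then have "rect_map B A p \<in> region A" by (simp add: nondegenerate rect_map_in_region)
    then show ?thesis using 2 subset
      by (auto simp: swap_fst swap_snd rect_map_comp rect_map_self nondegenerate)
  qed (use assms swap_outside in simp)
qed

lemma swap_Bij: "swap A B \<in> Bij unit_square"
  by (rule BijI_inverse[of _ _ "swap A B"]) (simp_all add: swap_extensional swap_involution)

lemma rect_pair_subset:
  assumes "nondegenerate C" "nondegenerate D" "region C \<subseteq> region A" "region D \<subseteq> region B"
  shows "rect_pair C D"
  using assms subset disjoint by unfold_locales blast+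

end

lemma pattern_rect_pair:
  "pattern P \<Longrightarrow> A \<in> P \<Longrightarrow> B \<in> P \<Longrightarrow> A \<noteq> B \<Longrightarrow> rect_pair A B"
  by unfold_locales
    (auto dest: pattern_nondegenerate pattern_region_subset pattern_disjoint)

locale subrect =
  fixes R :: rect
  assumes nondegenerate: "nondegenerate R"
    and subset: "region R \<subseteq> unit_square"
begin

lemmas vertical_region = division_region[OF nondegenerate division_halves(1)]
lemmas horizontal_region = division_region[OF nondegenerate division_halves(2)]

lemma baker_left: "p \<in> region (left_half R) \<Longrightarrow> baker R p = rect_map (left_half R) (lower_half R) p"
  using subset vertical_region(1) by (auto simp: baker_def)

lemma baker_right: "p \<in> region (right_half R) \<Longrightarrow> baker R p = rect_map (right_half R) (upper_half R) p"
  using subset vertical_region(1,2) by (auto simp: baker_def)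

lemma baker_outside: "p \<in> unit_square \<Longrightarrow> p \<notin> region R \<Longrightarrow> baker R p = p"
  using vertical_region(1) by (simp add: baker_def)

lemma baker_Bij: "baker R \<in> Bij unit_square"
proof -
  \<comment> \<open>The inverse of \<open>baker R\<close>: lower half back to left half, upper half
    back to right half. Only its values on the square matter.\<close>
  define g where "g p = (if p \<in> region (lower_half R) then rect_map (lower_half R) (left_half R) p
    else if p \<in> region (upper_half R) then rect_map (upper_half R) (right_half R) p else p)" for p
  note nd = vertical_region(3,4) horizontal_region(3,4)
  have g_lower: "g p = rect_map (lower_half R) (left_half R) p" if "p \<in> region (lower_half R)" for p
    using that by (simp add: g_def)
  have g_upper: "g p = rect_map (upper_half R) (right_half R) p" if "p \<in> region (upper_half R)" for p
    using that horizontal_region(2) by (auto simp: g_def)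
  have g_outside: "g p = p" if "p \<notin> region R" for p
    using that horizontal_region(1) by (auto simp: g_def)
  show ?thesis
  proof (rule BijI_inverse[of _ _ g])
    fix p assume p: "p \<in> unit_square"
    consider "p \<in> region (left_half R)" | "p \<in> region (right_half R)" | "p \<notin> region R"
      using vertical_region(1) by blast
    then show "baker R p \<in> unit_square \<and> g (baker R p) = p"
    proof cases
      case 1
      then have "rect_map (left_half R) (lower_half R) p \<in> region (lower_half R)"
        by (simp add: nd rect_map_in_region)
      then show ?thesis using 1 subset horizontal_region(1)
        by (auto simp: baker_left g_lower rect_map_comp rect_map_self nd)
    next
      case 2
      then have "rect_map (right_half R) (upper_half R) p \<in> region (upper_half R)"
        by (simp add: nd rect_map_in_region)
      then show ?thesis using 2 subset horizontal_region(1)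
        by (auto simp: baker_right g_upper rect_map_comp rect_map_self nd)
    qed (use p in \<open>simp add: baker_outside g_outside\<close>)
    consider "p \<in> region (lower_half R)" | "p \<in> region (upper_half R)" | "p \<notin> region R"
      using horizontal_region(1) by blast
    then show "g p \<in> unit_square \<and> baker R (g p) = p"
    proof cases
      case 1
      then have "rect_map (lower_half R) (left_half R) p \<in> region (left_half R)"
        by (simp add: nd rect_map_in_region)
      then show ?thesis using 1 subset vertical_region(1)
        by (auto simp: baker_left g_lower rect_map_comp rect_map_self nd)
    next
      case 2
      then have "rect_map (upper_half R) (right_half R) p \<in> region (right_half R)"
        by (simp add: nd rect_map_in_region)
      then show ?thesis using 2 subset vertical_region(1)
        by (auto simp: baker_right g_upper rect_map_comp rect_map_self nd)
    qed (use p in \<open>simp add: baker_outside g_outside\<close>)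
  qed (simp add: baker_extensional)
qed

end

lemma pattern_subrect: "pattern P \<Longrightarrow> R \<in> P \<Longrightarrow> subrect R"
  by unfold_locales (auto dest: pattern_nondegenerate pattern_region_subset)

section \<open>Identities between swaps and baker's maps\<close>

context subrect
begin

lemma subrect_halves:
  "subrect (left_half R)" "subrect (right_half R)" "subrect (lower_half R)" "subrect (upper_half R)"
  using subset vertical_region horizontal_region by (unfold_locales; blast)+

text \<open>In binary digits, the product of the baker's maps of the two halves sends
  \<open>(i k x, j y)\<close> to \<open>(i x, k j y)\<close>, whereas the baker's map of the whole sends it to
  \<open>(k x, i j y)\<close>: they differ by exchanging the leading digits \<open>i\<close> and \<open>k\<close>.\<close>

lemma baker_eq_swap_baker_halves:
  "baker R = compose unit_square (swap (upper_half (left_half R)) (lower_half (right_half R)))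
     (compose unit_square (baker (left_half R)) (baker (right_half R)))"
    (is "_ = compose _ ?t (compose _ ?bl ?br)")
proof (rule extensionalityI[where A = unit_square])
  fix p assume p: "p \<in> unit_square"
  interpret L: subrect "left_half R" by (rule subrect_halves)
  interpret R: subrect "right_half R" by (rule subrect_halves)
  \<comment> \<open>The two quarters lie in different vertical halves of \<open>R\<close>, hence are
    disjoint.\<close>
  interpret t: rect_pair "upper_half (left_half R)" "lower_half (right_half R)"
    using L.subset R.subset L.horizontal_region R.horizontal_region vertical_region(2)
    by unfold_locales blast+
  note nd = nondegenerate L.nondegenerate R.nondegenerate L.vertical_region(3,4) R.vertical_region(3,4) L.horizontal_region(3,4)
    R.horizontal_region(3,4)
  note sub = L.vertical_region(1) R.vertical_region(1) L.horizontal_region(1)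
    R.horizontal_region(1)
  \<comment> \<open>Four vertical strips fix the two leading digits of the first coordinate. In the
    outer strips the digits agree and the swap does nothing; in the inner ones they differ and the
    swap exchanges them.\<close>
  consider "p \<in> region (left_half (left_half R))" | "p \<in> region (right_half (left_half R))"
    | "p \<in> region (left_half (right_half R))" | "p \<in> region (right_half (right_half R))"
    | "p \<notin> region R"
    using vertical_region(1) sub by blast
  then have "baker R p = ?t (?bl (?br p))"
  proof cases
    case 1
    let ?q = "rect_map (left_half (left_half R)) (lower_half (left_half R)) p"
    have q: "?q \<in> region (lower_half (left_half R))" by (intro rect_map_in_region nd 1)
    have "?br p = p" using p 1 sub vertical_region(2) by (intro R.baker_outside) auto
    moreover have "?bl p = ?q" by (rule L.baker_left[OF 1])
    moreover have "?t ?q = ?q"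
      using q L.subset sub L.horizontal_region(2) vertical_region(2) by (intro swap_outside) auto
    moreover have "baker R p = ?q"
      using 1 sub by (simp add: baker_left rect_map_halves horizontal_region(3,4) nd flip: half_of_half_commute)
    ultimately show ?thesis by simp
  next
    case 2
    let ?q = "rect_map (right_half (left_half R)) (upper_half (left_half R)) p"
    have q: "?q \<in> region (upper_half (left_half R))" by (intro rect_map_in_region nd 2)
    have "?br p = p" using p 2 sub vertical_region(2) by (intro R.baker_outside) auto
    moreover have "?bl p = ?q" by (rule L.baker_right[OF 2])
    moreover have "?t ?q = rect_map (right_half (left_half R)) (lower_half (right_half R)) p"
      using q by (simp add: t.swap_fst rect_map_comp nd)
    moreover have "baker R p = rect_map (right_half (left_half R)) (lower_half (right_half R)) p"
      using 2 sub by (simp add: baker_left rect_map_halves horizontal_region(3,4) nd flip: half_of_half_commute)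
    ultimately show ?thesis by simp
  next
    case 3
    let ?q = "rect_map (left_half (right_half R)) (lower_half (right_half R)) p"
    have q: "?q \<in> region (lower_half (right_half R))" by (intro rect_map_in_region nd 3)
    have "?br p = ?q" by (rule R.baker_left[OF 3])
    moreover have "?bl ?q = ?q"
      using q R.subset sub vertical_region(2) by (intro L.baker_outside) auto
    moreover have "?t ?q = rect_map (left_half (right_half R)) (upper_half (left_half R)) p"
      using q by (simp add: t.swap_snd rect_map_comp nd)
    moreover have "baker R p = rect_map (left_half (right_half R)) (upper_half (left_half R)) p"
      using 3 sub by (simp add: baker_right rect_map_halves horizontal_region(3,4) nd flip: half_of_half_commute)
    ultimately show ?thesis by simp
  next
    case 4
    let ?q = "rect_map (right_half (right_half R)) (upper_half (right_half R)) p"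
    have q: "?q \<in> region (upper_half (right_half R))" by (intro rect_map_in_region nd 4)
    have "?br p = ?q" by (rule R.baker_right[OF 4])
    moreover have "?bl ?q = ?q"
      using q R.subset sub vertical_region(2) by (intro L.baker_outside) auto
    moreover have "?t ?q = ?q"
      using q R.subset sub R.horizontal_region(2) vertical_region(2) by (intro swap_outside) auto
    moreover have "baker R p = ?q"
      using 4 sub by (simp add: baker_right rect_map_halves horizontal_region(3,4) nd flip: half_of_half_commute)
    ultimately show ?thesis by simp
  next
    case 5
    then have "p \<notin> region (left_half R)" "p \<notin> region (right_half R)"
      using vertical_region(1) by blast+
    moreover from this have "p \<notin> region (upper_half (left_half R))"
      "p \<notin> region (lower_half (right_half R))"
      using L.horizontal_region(1) R.horizontal_region(1) by blast+
    ultimately show ?thesis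
      using p 5 by (simp add: baker_outside L.baker_outside R.baker_outside swap_outside)
  qed
  then show "baker R p = compose unit_square ?t (compose unit_square ?bl ?br) p"
    by (simp add: compose_eq p)
qed (simp_all add: baker_extensional)

end

context rect_pair
begin

sublocale A: subrect A using nondegenerate(1) subset(1) by unfold_locales
sublocale B: subrect B using nondegenerate(2) subset(2) by unfold_locales

lemma rect_pair_division:
  assumes "division A A1 A2" "division B B1 B2"
  shows "rect_pair A1 B1" "rect_pair A2 B2"
  using division_region[OF nondegenerate(1) assms(1)] division_region[OF nondegenerate(2) assms(2)]
  by (intro rect_pair_subset; blast)+

text \<open>Corresponding halves are moved by restrictions of the same affine maps, and the two
  factors have disjoint supports. This handles a swap in a pattern of only two rectangles, which
  need not be proper as it stands.\<close>

lemma swap_eq_swap_halves: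
  "swap A B = compose unit_square (swap (left_half A) (left_half B))
     (swap (right_half A) (right_half B))" (is "_ = compose _ ?l ?r")
proof (rule extensionalityI[where A = unit_square])
  fix p assume p: "p \<in> unit_square"
  interpret l: rect_pair "left_half A" "left_half B"
    by (rule rect_pair_division[OF division_halves(1) division_halves(1)])
  interpret r: rect_pair "right_half A" "right_half B"
    by (rule rect_pair_division[OF division_halves(1) division_halves(1)])
  note dis = A.vertical_region(1,2) B.vertical_region(1,2) disjoint
  consider "p \<in> region (left_half A)" | "p \<in> region (right_half A)"
    | "p \<in> region (left_half B)" | "p \<in> region (right_half B)"
    | "p \<notin> region A" "p \<notin> region B"
    using dis by blast
  then have "swap A B p = ?l (?r p)"
  proof cases
    case 1
    then have "?r p = p" using p dis by (intro swap_outside) auto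
    then show ?thesis using 1 dis by (simp add: swap_fst l.swap_fst rect_map_halves nondegenerate)
  next
    case 2
    then have "rect_map A B p \<in> region (right_half B)"
      using rect_map_in_region[OF r.nondegenerate] by (simp add: rect_map_halves nondegenerate)
    then have "?l (rect_map A B p) = rect_map A B p"
      using r.subset dis by (intro swap_outside) auto
    then show ?thesis using 2 dis by (simp add: swap_fst r.swap_fst rect_map_halves nondegenerate)
  next
    case 3
    then have "?r p = p" using p dis by (intro swap_outside) auto
    then show ?thesis using 3 dis by (simp add: swap_snd l.swap_snd rect_map_halves nondegenerate)
  next
    case 4
    then have "rect_map B A p \<in> region (right_half A)"
      using rect_map_in_region[OF r.nondegenerate(2,1)] by (simp add: rect_map_halves nondegenerate)
    then have "?l (rect_map B A p) = rect_map B A p"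
      using r.subset dis by (intro swap_outside) auto
    then show ?thesis using 4 dis by (simp add: swap_snd r.swap_snd rect_map_halves nondegenerate)
  next
    case 5
    then show ?thesis using p dis by (simp add: swap_outside)
  qed
  then show "swap A B p = compose unit_square ?l ?r p"
    by (simp add: compose_eq p)
qed (simp_all add: swap_extensional)

text \<open>With \<open>s = swap A B\<close>, the first two swaps compose to \<open>baker A \<circ> s \<circ> inverse (baker A)\<close>,
  and \<open>inverse (baker A)\<close> is carried to \<open>inverse (baker B)\<close> by \<open>s\<close>.\<close>

lemma baker_eq_swaps_baker:
  "baker A = compose unit_square (swap (lower_half A) (left_half B))
     (compose unit_square (swap (upper_half A) (right_half B))
       (compose unit_square (swap A B) (baker B)))"
    (is "_ = compose _ ?l (compose _ ?u (compose _ ?s ?b))")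
proof (rule extensionalityI[where A = unit_square])
  fix p assume p: "p \<in> unit_square"
  interpret l: rect_pair "lower_half A" "left_half B"
    by (rule rect_pair_division[OF division_halves(2) division_halves(1)])
  interpret u: rect_pair "upper_half A" "right_half B"
    by (rule rect_pair_division[OF division_halves(2) division_halves(1)])
  note nd = nondegenerate A.vertical_region(3,4) B.vertical_region(3,4) A.horizontal_region(3,4)
    B.horizontal_region(3,4)
  note dis = A.vertical_region(1,2) B.vertical_region(1,2) A.horizontal_region(1,2)
    B.horizontal_region(1,2) disjoint
  \<comment> \<open>A point of \<open>A\<close> is fixed by \<open>baker B\<close>, sent to
    \<open>B\<close> by the big swap, and returned by one of the two smaller swaps to the half of
    \<open>A\<close> that \<open>baker A\<close> prescribes. A point of \<open>B\<close> is moved by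
    \<open>baker B\<close>, sent to \<open>A\<close>, and returned to where it started.\<close>
  consider "p \<in> region (left_half A)" | "p \<in> region (right_half A)"
    | "p \<in> region (left_half B)" | "p \<in> region (right_half B)"
    | "p \<notin> region A" "p \<notin> region B"
    using dis by blast
  then have "baker A p = ?l (?u (?s (?b p)))"
  proof cases
    case 1
    let ?q = "rect_map (left_half A) (left_half B) p"
    have q: "?q \<in> region (left_half B)" by (intro rect_map_in_region nd 1)
    have "?b p = p" using p 1 dis by (intro B.baker_outside) auto
    moreover have "?s p = ?q" using 1 dis by (simp add: swap_fst rect_map_halves nondegenerate)
    moreover have "?u ?q = ?q" using q l.subset dis by (intro swap_outside) auto
    moreover have "?l ?q = baker A p"
      using 1 q by (simp add: A.baker_left l.swap_snd rect_map_comp nd)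
    ultimately show ?thesis by simp
  next
    case 2
    let ?q = "rect_map (right_half A) (right_half B) p"
    have q: "?q \<in> region (right_half B)" by (intro rect_map_in_region nd 2)
    have q': "rect_map (right_half A) (upper_half A) p \<in> region (upper_half A)"
      by (intro rect_map_in_region nd 2)
    have "?b p = p" using p 2 dis by (intro B.baker_outside) auto
    moreover have "?s p = ?q" using 2 dis by (simp add: swap_fst rect_map_halves nondegenerate)
    moreover have "?u ?q = baker A p"
      using 2 q by (simp add: A.baker_right u.swap_snd rect_map_comp nd)
    moreover have "?l (baker A p) = baker A p"
      using 2 q' u.subset dis by (intro swap_outside) (auto simp: A.baker_right)
    ultimately show ?thesis by simp
  next
    case 3
    let ?q = "rect_map (left_half B) (lower_half B) p"
    let ?r = "rect_map (left_half B) (lower_half A) p"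
    have q: "?q \<in> region (lower_half B)" and r: "?r \<in> region (lower_half A)"
      by (intro rect_map_in_region nd 3)+
    have "?b p = ?q" using 3 by (simp add: B.baker_left)
    moreover have "?q \<in> region B" using q dis by blast
    then have "?s ?q = rect_map (lower_half B) (lower_half A) ?q"
      by (simp add: swap_snd rect_map_halves nondegenerate)
    then have "?s ?q = ?r" by (simp add: rect_map_comp nd)
    moreover have "?u ?r = ?r" using r l.subset dis by (intro swap_outside) auto
    moreover have "?l ?r = p"
      using r by (simp add: l.swap_fst rect_map_comp rect_map_self nd)
    moreover have "baker A p = p" using p 3 dis by (intro A.baker_outside) auto
    ultimately show ?thesis by simp
  next
    case 4
    let ?q = "rect_map (right_half B) (upper_half B) p"
    let ?r = "rect_map (right_half B) (upper_half A) p"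
    have q: "?q \<in> region (upper_half B)" and r: "?r \<in> region (upper_half A)"
      by (intro rect_map_in_region nd 4)+
    have "?b p = ?q" using 4 by (simp add: B.baker_right)
    moreover have "?q \<in> region B" using q dis by blast
    then have "?s ?q = rect_map (upper_half B) (upper_half A) ?q"
      by (simp add: swap_snd rect_map_halves nondegenerate)
    then have "?s ?q = ?r" by (simp add: rect_map_comp nd)
    moreover have "?u ?r = p"
      using r by (simp add: u.swap_fst rect_map_comp rect_map_self nd)
    moreover have "?l p = p" using p 4 dis by (intro swap_outside) auto
    moreover have "baker A p = p" using p 4 dis by (intro A.baker_outside) auto
    ultimately show ?thesis by simp
  next
    case 5
    then have "p \<notin> region (lower_half A)" "p \<notin> region (upper_half A)"
      "p \<notin> region (left_half B)" "p \<notin> region (right_half B)"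
      using dis by blast+
    then show ?thesis
      using 5 p by (simp add: swap_outside A.baker_outside B.baker_outside)
  qed
  then show "baker A p = compose unit_square ?l (compose unit_square ?u
      (compose unit_square ?s ?b)) p"
    by (simp add: compose_eq p)
qed (simp_all add: baker_extensional)

end

section \<open>The subgroup generated by proper swaps\<close>

abbreviation square_group :: "(point \<Rightarrow> point) monoid" where
  "square_group \<equiv> BijGroup unit_square"

text \<open>Uses sets of rectangles; a numbering is chosen only on the way back to
  \<open>proper_transposition\<close>.\<close>

definition proper_swaps :: "(point \<Rightarrow> point) set" where
  "proper_swaps = {swap A B | A B P. pattern P \<and> card P > 2 \<and> A \<in> P \<and> B \<in> P \<and> A \<noteq> B}"

text \<open>Generated inside the group of all bijections of the square, so that no closure property
  of \<open>two_V\<close> has to be established.\<close>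

definition swap_group :: "(point \<Rightarrow> point) set" where
  "swap_group = generate square_group proper_swaps"

lemma square_group_mult:
  "f \<in> Bij unit_square \<Longrightarrow> g \<in> Bij unit_square \<Longrightarrow>
     f \<otimes>\<^bsub>square_group\<^esub> g = compose unit_square f g"
  by (simp add: BijGroup_def)

lemma square_group_carrier: "carrier square_group = Bij unit_square"
  by (simp add: BijGroup_def)

lemma proper_swapsE:
  assumes "t \<in> proper_swaps"
  obtains A B P where "t = swap A B" "pattern P" "card P > 2" "A \<in> P" "B \<in> P" "A \<noteq> B"
    "rect_pair A B"
  using assms pattern_rect_pair unfolding proper_swaps_def by blast

lemma proper_swaps_Bij: "proper_swaps \<subseteq> Bij unit_square"
  by (auto elim!: proper_swapsE intro: rect_pair.swap_Bij)

text \<open>Swaps are involutions. Hence inverses of generators are generators, and group elements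
  become plain products.\<close>

lemma proper_swap_inv:
  assumes "t \<in> proper_swaps"
  shows "inv\<^bsub>square_group\<^esub> t = t"
proof -
  obtain A B where t: "t = swap A B" and pair: "rect_pair A B"
    using assms by (rule proper_swapsE)
  interpret rect_pair A B by (rule pair)
  have "compose unit_square t t = (\<lambda>p\<in>unit_square. p)"
    by (rule extensionalityI[where A = unit_square]) (simp_all add: compose_eq t swap_involution)
  then have "t \<otimes>\<^bsub>square_group\<^esub> t = \<one>\<^bsub>square_group\<^esub>"
    using swap_Bij by (simp add: square_group_mult t) (simp add: BijGroup_def)
  then show ?thesis
    using swap_Bij by (intro group.inv_equality[OF group_BijGroup]) (simp_all add: t square_group_carrier)
qed

lemma proper_swap_proper_transposition:
  assumes "t \<in> proper_swaps"
  shows "proper_transposition t" "t \<in> carrier two_V"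
proof -
  obtain A B P where t: "t = swap A B" and P: "pattern P" "card P > 2"
    and AB: "A \<in> P" "B \<in> P" "A \<noteq> B" and pair: "rect_pair A B"
    using assms by (rule proper_swapsE)
  interpret rect_pair A B by (rule pair)
  \<comment> \<open>Any enumeration without repetition serves as numbering. Exchanging two entries
    keeps its set, so domain and range have the same pattern.\<close>
  obtain Ps where Ps: "set Ps = P" "distinct Ps"
    using finite_distinct_list[OF pattern_finite[OF P(1)]] by blast
  obtain i j where i: "i < length Ps" "Ps ! i = A" and j: "j < length Ps" "Ps ! j = B"
    using AB Ps(1) by (metis in_set_conv_nth)
  have ij: "i \<noteq> j" using i j AB(3) by blast
  let ?Qs = "Ps[i := Ps ! j, j := Ps ! i]"
  have "t p = rect_map (Ps ! k) (?Qs ! k) p" if k: "k < length Ps" "p \<in> region (Ps ! k)" for k p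
  proof -
    consider "k = i" | "k = j" | "k \<noteq> i" "k \<noteq> j" by blast
    then show ?thesis
    proof cases
      case 1
      then show ?thesis using k i j ij by (simp add: t swap_fst)
    next
      case 2
      then show ?thesis using k i j ij by (simp add: t swap_snd)
    next
      case 3
      have C: "Ps ! k \<in> P" using k Ps(1) by auto
      have "Ps ! k \<noteq> A" "Ps ! k \<noteq> B"
        using 3 k i j Ps(2) by (auto simp: nth_eq_iff_index_eq)
      then have "region (Ps ! k) \<inter> region A = {}" "region (Ps ! k) \<inter> region B = {}"
        using C AB P(1) by (auto dest: pattern_disjoint)
      moreover have "p \<in> unit_square" using pattern_region_subset[OF P(1) C] k by blast
      ultimately have "t p = p" using k unfolding t by (intro swap_outside) auto
      then show ?thesis using 3 k pattern_nondegenerate[OF P(1) C] by (simp add: rect_map_self)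
    qed
  qed
  moreover have "distinct ?Qs" "set ?Qs = P"
    using Ps i(1) j(1) by (simp_all only: distinct_swap set_swap)
  moreover have "t \<in> Bij unit_square" unfolding t by (rule swap_Bij)
  ultimately have ind: "induced_by Ps ?Qs t"
    using Ps P(1) by (simp add: induced_by_def numbered_pattern_def)
  moreover have "length Ps > 2" using P(2) Ps distinct_card by metis
  ultimately show "proper_transposition t" using i j ij unfolding proper_transposition_def by blast
  show "t \<in> carrier two_V" using ind by (auto simp: two_V_def)
qed

lemma swap_group_subgroup: "subgroup swap_group square_group"
  unfolding swap_group_def
  by (rule group.generate_is_subgroup[OF group_BijGroup])
    (simp add: square_group_carrier proper_swaps_Bij)

lemma swap_group_compose:
  assumes "f \<in> swap_group" "g \<in> swap_group"
  shows "compose unit_square f g \<in> swap_group"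
proof -
  have "f \<in> Bij unit_square" "g \<in> Bij unit_square"
    using assms subgroup.mem_carrier[OF swap_group_subgroup] by (simp_all add: square_group_carrier)
  then show ?thesis
    using subgroup.m_closed[OF swap_group_subgroup assms] by (simp add: square_group_mult)
qed

text \<open>Induction on generation: the unit is the empty list, a generator or its inverse a list
  of one entry, a product the concatenation.\<close>

lemma swap_group_product:
  assumes "f \<in> swap_group"
  shows "\<exists>ts. set ts \<subseteq> proper_swaps \<and> f = foldr (\<otimes>\<^bsub>square_group\<^esub>) ts \<one>\<^bsub>square_group\<^esub>"
proof -
  interpret group square_group by (rule group_BijGroup)
  have closed: "foldr (\<otimes>\<^bsub>square_group\<^esub>) ts \<one>\<^bsub>square_group\<^esub> \<in> carrier square_group"
    if "set ts \<subseteq> proper_swaps" for ts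
    using that proper_swaps_Bij
    by (induction ts) (auto simp flip: square_group_carrier)
  have append: "foldr (\<otimes>\<^bsub>square_group\<^esub>) (ts @ us) \<one>\<^bsub>square_group\<^esub>
      = foldr (\<otimes>\<^bsub>square_group\<^esub>) ts \<one>\<^bsub>square_group\<^esub>
        \<otimes>\<^bsub>square_group\<^esub> foldr (\<otimes>\<^bsub>square_group\<^esub>) us \<one>\<^bsub>square_group\<^esub>"
    if "set ts \<subseteq> proper_swaps" "set us \<subseteq> proper_swaps" for ts us
    using that(1)
  proof (induction ts)
    case Nil
    then show ?case using closed[OF that(2)] by simp
  next
    case (Cons t ts)
    then have "t \<in> carrier square_group" using proper_swaps_Bij by (auto simp: square_group_carrier)
    then show ?case using Cons closed[of ts] closed[OF that(2)] by (simp add: m_assoc)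
  qed
  have single: "\<exists>ts. set ts \<subseteq> proper_swaps \<and> t = foldr (\<otimes>\<^bsub>square_group\<^esub>) ts \<one>\<^bsub>square_group\<^esub>"
    if "t \<in> proper_swaps" for t
  proof -
    have "t \<in> carrier square_group" using that proper_swaps_Bij by (auto simp: square_group_carrier)
    then show ?thesis using that by (intro exI[of _ "[t]"]) simp
  qed
  show ?thesis
    using assms unfolding swap_group_def
  proof (induction rule: generate.induct)
    case one
    show ?case by (intro exI[of _ "[]"]) simp
  next
    case (incl h)
    then show ?case by (rule single)
  next
    case (inv h)
    then show ?case using single proper_swap_inv by simp
  next
    case (eng f g)
    then obtain ts us where "set ts \<subseteq> proper_swaps" "set us \<subseteq> proper_swaps"
      "f = foldr (\<otimes>\<^bsub>square_group\<^esub>) ts \<one>\<^bsub>square_group\<^esub>"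
      "g = foldr (\<otimes>\<^bsub>square_group\<^esub>) us \<one>\<^bsub>square_group\<^esub>" by blast
    then show ?case using append by (intro exI[of _ "ts @ us"]) auto
  qed
qed

section \<open>Baker's maps modulo the swap group\<close>

lemma swap_in_swap_group:
  assumes P: "pattern P" "R \<in> P" "R' \<in> P" "R \<noteq> R'"
    and div: "division R A B" "division R' A' B'"
    and XY: "X \<in> {A, B}" "Y \<in> {A', B'}"
  shows "swap X Y \<in> swap_group"
proof -
  \<comment> \<open>Cutting both rectangles yields at least four, so a swap of pieces is proper even
    if \<open>P\<close> consists of \<open>R\<close> and \<open>R'\<close> alone.\<close>
  let ?Q = "(P - {R} \<union> {A, B}) - {R'} \<union> {A', B'}"
  have Q: "pattern ?Q"
    using P div by (intro pattern_division) auto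
  note dR = division_region[OF pattern_nondegenerate[OF P(1,2)] div(1)]
    division_region[OF pattern_nondegenerate[OF P(1,3)] div(2)]
  have disj: "region R \<inter> region R' = {}" using pattern_disjoint P by blast
  \<comment> \<open>A nonempty region inside \<open>R\<close> cannot also lie inside
    \<open>R'\<close>.\<close>
  have sep: "C \<noteq> D" if "nondegenerate C" "region C \<subseteq> region R" "region D \<subseteq> region R'" for C D
    using that disj region_nonempty[of C] by auto
  have "A \<noteq> B" "A' \<noteq> B'"
    using division_distinct pattern_nondegenerate P div by blast+
  moreover have "A \<noteq> A'" "A \<noteq> B'" "B \<noteq> A'" "B \<noteq> B'" "A \<noteq> R'" "B \<noteq> R'"
    using dR(1,3,4,5) by (intro sep; simp)+
  ultimately have distinct: "A \<noteq> B" "A \<noteq> A'" "A \<noteq> B'" "B \<noteq> A'" "B \<noteq> B'" "A' \<noteq> B'"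
    "A \<noteq> R'" "B \<noteq> R'"
    by simp_all
  have sub: "{A, B, A', B'} \<subseteq> ?Q" using distinct by blast
  have "card {A, B, A', B'} = 4" using distinct by simp
  then have "card ?Q > 2" using card_mono[OF pattern_finite[OF Q] sub] by linarith
  then have "swap X Y \<in> proper_swaps"
    using Q sub XY distinct unfolding proper_swaps_def by blast
  then show ?thesis unfolding swap_group_def by (rule generate.incl)
qed

text \<open>The three swaps in \<open>baker_eq_swaps_baker\<close> form the factor \<open>t\<close>,
  so the baker's maps of one pattern share a right coset of \<open>swap_group\<close>.\<close>

lemma baker_coset:
  assumes P: "pattern P" "R \<in> P" "R' \<in> P" "R \<noteq> R'"
  shows "\<exists>t\<in>swap_group. baker R = compose unit_square t (baker R')"
proof -
  interpret rect_pair R R' by (rule pattern_rect_pair[OF P])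
  note swaps = swap_in_swap_group[OF P division_halves(1) division_halves(1)]
    swap_in_swap_group[OF P division_halves(2) division_halves(1)]
  \<comment> \<open>\<open>P\<close> may have just two rectangles, so the swap is first split into
    swaps of halves.\<close>
  have s: "swap R R' \<in> swap_group"
    unfolding swap_eq_swap_halves by (intro swap_group_compose swaps) simp_all
  let ?t = "compose unit_square (swap (lower_half R) (left_half R'))
    (compose unit_square (swap (upper_half R) (right_half R')) (swap R R'))"
  have "?t \<in> swap_group" by (intro swap_group_compose swaps s) simp_all
  \<comment> \<open>Reassociation needs \<open>baker R'\<close> to keep points in the square,
    because \<open>compose\<close> restricts to it.\<close>
  moreover have "baker R' \<in> Bij unit_square" by (rule B.baker_Bij)
  then have "baker R' \<in> unit_square \<rightarrow> unit_square" by (rule Bij_imp_funcset)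
  then have "baker R = compose unit_square ?t (baker R')"
    by (subst baker_eq_swaps_baker) (auto simp: compose_def fun_eq_iff)
  ultimately show ?thesis by blast
qed

text \<open>Cancelling \<open>b\<close> on the right leaves \<open>t c x = 1\<close>, so
  \<open>c\<close> is the product of the inverses of \<open>t\<close> and \<open>x\<close>. It is
  applied with \<open>b\<close> and \<open>c\<close> the baker's maps of a rectangle and of its left
  half.\<close>

lemma middle_factor_mem_subgroup:
  assumes "group G" "subgroup H G" "t \<in> H" "x \<in> H" "b \<in> carrier G" "c \<in> carrier G"
    and eq: "b = t \<otimes>\<^bsub>G\<^esub> (c \<otimes>\<^bsub>G\<^esub> (x \<otimes>\<^bsub>G\<^esub> b))"
  shows "c \<in> H"
proof -
  interpret group G by (rule assms(1))
  interpret H: subgroup H G by (rule assms(2))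
  have tx: "t \<in> carrier G" "x \<in> carrier G" using assms(3,4) by simp_all
  have "((t \<otimes>\<^bsub>G\<^esub> c) \<otimes>\<^bsub>G\<^esub> x) \<otimes>\<^bsub>G\<^esub> b = t \<otimes>\<^bsub>G\<^esub> (c \<otimes>\<^bsub>G\<^esub> (x \<otimes>\<^bsub>G\<^esub> b))"
    using tx assms(5,6) by (simp add: m_assoc)
  then have "((t \<otimes>\<^bsub>G\<^esub> c) \<otimes>\<^bsub>G\<^esub> x) \<otimes>\<^bsub>G\<^esub> b = b" by (simp only: eq[symmetric])
  then have "(t \<otimes>\<^bsub>G\<^esub> c) \<otimes>\<^bsub>G\<^esub> x = \<one>\<^bsub>G\<^esub>"
    using tx assms(5,6) by simp
  then have "t \<otimes>\<^bsub>G\<^esub> c = inv\<^bsub>G\<^esub> x"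
    using tx assms(6) by (intro inv_equality[symmetric]) simp_all
  then have "c = inv\<^bsub>G\<^esub> t \<otimes>\<^bsub>G\<^esub> inv\<^bsub>G\<^esub> x"
    using tx assms(6) by (intro inv_solve_left[THEN iffD2]) simp_all
  then show ?thesis using assms(3,4) by simp
qed

text \<open>After a vertical cut of \<open>R\<close>, the quarters are pieces of two distinct
  rectangles of one pattern.\<close>

lemma swap_quarters_in_swap_group:
  assumes P: "pattern P" "R \<in> P"
  shows "swap (upper_half (left_half R)) (lower_half (right_half R)) \<in> swap_group"
proof (rule swap_in_swap_group[OF _ _ _ _ division_halves(2) division_halves(2)])
  show "pattern (P - {R} \<union> {left_half R, right_half R})" by (rule pattern.vertical[OF P])
  interpret subrect R by (rule pattern_subrect[OF P])
  show "left_half R \<noteq> right_half R"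
    by (rule division_distinct[OF nondegenerate division_halves(1)])
qed auto

lemma baker_in_swap_group_secondary:
  assumes P: "pattern P" "R \<in> P" "R' \<in> P" "R \<noteq> R'"
  shows "baker R \<in> swap_group"
proof -
  interpret rect_pair R R' by (rule pattern_rect_pair[OF P])
  let ?L = "left_half R" and ?Rt = "right_half R"
  let ?Q = "P - {R} \<union> {?L, ?Rt}"
  have Q: "pattern ?Q" by (rule pattern.vertical[OF P(1,2)])
  interpret L: subrect ?L by (rule A.subrect_halves)
  interpret Rt: subrect ?Rt by (rule A.subrect_halves)
  have ne: "?L \<noteq> ?Rt"
    by (rule division_distinct[OF A.nondegenerate division_halves(1)])
  have ne': "?Rt \<noteq> R'"
    using A.vertical_region(1) region_nonempty[OF A.vertical_region(4)] disjoint by auto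
  let ?t = "swap (upper_half ?L) (lower_half ?Rt)"
  have t: "?t \<in> swap_group" by (rule swap_quarters_in_swap_group[OF P(1,2)])
  \<comment> \<open>A rectangle and its half never occur in the same pattern. \<open>R'\<close> is
    the bridge: it shares the refined pattern with the right half and the original one with
    \<open>R\<close>.\<close>
  obtain x where x: "x \<in> swap_group" "baker ?Rt = compose unit_square x (baker R')"
    using baker_coset[OF Q, of ?Rt R'] ne' P by auto
  obtain y where y: "y \<in> swap_group" "baker R' = compose unit_square y (baker R)"
    using baker_coset[OF P(1,3,2)] P(4) by auto
  obtain z where z: "z \<in> swap_group" "baker ?Rt = compose unit_square z (baker ?L)"
    using baker_coset[OF Q, of ?Rt ?L] ne by auto
  interpret group square_group by (rule group_BijGroup)
  have Bij: "f \<in> Bij unit_square" if "f \<in> swap_group" for f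
    using that subgroup.mem_carrier[OF swap_group_subgroup] by (simp add: square_group_carrier)
  note bij = A.baker_Bij B.baker_Bij L.baker_Bij Rt.baker_Bij Bij[OF t] Bij[OF x(1)] Bij[OF y(1)]
  have "baker ?Rt = x \<otimes>\<^bsub>square_group\<^esub> (y \<otimes>\<^bsub>square_group\<^esub> baker R)"
    using x(2) y(2) bij by (simp add: square_group_mult)
  then have Rt: "baker ?Rt = (x \<otimes>\<^bsub>square_group\<^esub> y) \<otimes>\<^bsub>square_group\<^esub> baker R"
    using bij by (simp add: m_assoc square_group_carrier)
  have "compose unit_square (baker ?L) (baker ?Rt) \<in> Bij unit_square"
    using bij by (intro compose_Bij)
  then have "baker R = ?t \<otimes>\<^bsub>square_group\<^esub> (baker ?L \<otimes>\<^bsub>square_group\<^esub> baker ?Rt)"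
    using A.baker_eq_swap_baker_halves bij by (simp add: square_group_mult)
  then have eq: "baker R = ?t \<otimes>\<^bsub>square_group\<^esub> (baker ?L \<otimes>\<^bsub>square_group\<^esub>
      ((x \<otimes>\<^bsub>square_group\<^esub> y) \<otimes>\<^bsub>square_group\<^esub> baker R))"
    by (simp only: Rt)
  have xy: "x \<otimes>\<^bsub>square_group\<^esub> y \<in> swap_group"
    by (rule subgroup.m_closed[OF swap_group_subgroup x(1) y(1)])
  have L: "baker ?L \<in> swap_group"
    by (rule middle_factor_mem_subgroup[OF is_group swap_group_subgroup t xy _ _ eq])
      (simp_all add: square_group_carrier bij)
  then have "baker ?Rt \<in> swap_group"
    unfolding z(2) by (intro swap_group_compose z(1))
  then show ?thesis
    unfolding A.baker_eq_swap_baker_halves by (intro swap_group_compose t L)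
qed

text \<open>After a vertical cut each half of \<open>R\<close> has the other as companion, so the
  secondary case covers both, also when \<open>R\<close> is the whole square.\<close>

lemma baker_in_swap_group:
  assumes P: "pattern P" "R \<in> P"
  shows "baker R \<in> swap_group"
proof -
  interpret subrect R by (rule pattern_subrect[OF P])
  let ?Q = "P - {R} \<union> {left_half R, right_half R}"
  have Q: "pattern ?Q" by (rule pattern.vertical[OF P])
  have ne: "left_half R \<noteq> right_half R"
    by (rule division_distinct[OF nondegenerate division_halves(1)])
  have "baker (left_half R) \<in> swap_group" "baker (right_half R) \<in> swap_group"
    using baker_in_swap_group_secondary[OF Q _ _ ne] baker_in_swap_group_secondary[OF Q _ _ ne[symmetric]]
    by simp_all
  then show ?thesis
    unfolding baker_eq_swap_baker_halves
    by (intro swap_group_compose swap_quarters_in_swap_group[OF P])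
qed

theorem lemma1:
  fixes f :: "point \<Rightarrow> point"
  assumes "baker_map f"
  shows "\<exists>ts. set ts \<subseteq> {t \<in> carrier two_V. proper_transposition t} \<and>
              f = foldr (\<otimes>\<^bsub>two_V\<^esub>) ts \<one>\<^bsub>two_V\<^esub>"
proof -
  have "f \<in> swap_group"
    using assms baker_in_swap_group unfolding baker_map_def by blast
  then obtain ts where "set ts \<subseteq> proper_swaps"
    "f = foldr (\<otimes>\<^bsub>square_group\<^esub>) ts \<one>\<^bsub>square_group\<^esub>"
    using swap_group_product by blast
  \<comment> \<open>\<open>two_V\<close> differs from the group of bijections only in its carrier,
    so products and unit are the same.\<close>
  then show ?thesis
    using proper_swap_proper_transposition by (intro exI[of _ ts]) (auto simp: two_V_def)
qed

end
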